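(* Let $\beta=(\beta_1,\dots,\beta_d)\in\mathbb{R}^d$. The reflection map $R=(\phi,\psi)$ is Lipschitz continuous with respect to $d_p$ on $\prod_{i=1}^d\mathbb{D}^{\beta_i}[0,T]$; that is, both $\phi$ and $\psi$ are Lipschitz continuous as maps from $\big(\prod_{i=1}^d\mathbb{D}^{\beta_i}[0,T],d_p\big)$ to $\big(\prod_{i=1}^d\mathbb{D}[0,T],d_p\big)$.
   Context: Fix $T>0$, $d\ge1$. $\mathbb{D}[0,T]$ is the space of real-valued càdlàg functions on $[0,T]$; $\Lambda[0,T]$ is the set of increasing homeomorphisms of $[0,T]$ onto itself; $e(t)=t$. The $J_1$ metric is $d_{J_1}(\xi,\zeta)=\inf_{\lambda\in\Lambda[0,T]}\big(\sup_t|\xi(\lambda(t))-\zeta(t)|\big)\vee\big(\sup_t|\lambda(t)-t|\big)$, and $d_p(\xi,\zeta)=\sum_{i=1}^d d_{J_1}(\xi_i,\zeta_i)$ on $\prod_{i=1}^d\mathbb{D}[0,T]$. $\mathbb{D}^{\uparrow}[0,T]$ is the set of non-decreasing $\xi\in\mathbb{D}[0,T]$ with $\xi(0)\ge0$; for $\beta\in\mathbb{R}$, $\mathbb{D}^{\beta}[0,T]=\{\xi+\beta e:\xi\in\mathbb{D}^{\uparrow}[0,T]\}$. Reflection map: $Q=[q_{ij}]$ is a $d\times d$ substochastic matrix ($q_{ij}\ge0$, row sums at most $1$) with $q_{ii}=0$ and $Q^n\to0$ as $n\to\infty$; $\mathcal{Q}=\mathrm{I}-Q^{\top}$. Vector and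 path inequalities are componentwise (and pointwise in $t$). For $\xi\in\prod_{i=1}^d\mathbb{D}[0,T]$ let $\Psi(\xi)=\{\zeta\in\prod_{i=1}^d\mathbb{D}^{\uparrow}[0,T]:\xi+\mathcal{Q}\zeta\ge0\}$. The regulator is $\psi(\xi)=\inf\Psi(\xi)$, i.e. $\psi_i(\xi)(t)=\inf\{\omega_i(t):\omega\in\Psi(\xi)\}$ (it is known that $\Psi(\xi)\neq\emptyset$ and $\psi(\xi)\in\Psi(\xi)$), and the content map is $\phi(\xi)=\xi+\mathcal{Q}\psi(\xi)$. *)

theory Defs
  imports "HOL-Analysis.Analysis"
begin

text \<open>
  A path on \<open>[0,T]\<close> is a total function on the reals of which only the values on \<open>{0..T}\<close>
  are ever inspected; a \<open>d\<close>-dimensional path is a \<open>'d\<close>-indexed family of such paths, where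
  \<open>'d\<close> is a finite type with \<open>d\<close> elements.
\<close>

definition cadlag_on :: "real \<Rightarrow> (real \<Rightarrow> real) \<Rightarrow> bool" where
  "cadlag_on T \<xi> \<longleftrightarrow>
     (\<forall>t\<in>{0..<T}. (\<xi> \<longlongrightarrow> \<xi> t) (at_right t)) \<and>
     (\<forall>t\<in>{0<..T}. \<exists>l. (\<xi> \<longlongrightarrow> l) (at_left t))"

definition skorokhod :: "real \<Rightarrow> (real \<Rightarrow> real) set" where
  "skorokhod T = {\<xi>. cadlag_on T \<xi>}"

definition skorokhod_incr :: "real \<Rightarrow> (real \<Rightarrow> real) set" where
  "skorokhod_incr T = {\<xi> \<in> skorokhod T. mono_on {0..T} \<xi> \<and> 0 \<le> \<xi> 0}"

definition skorokhod_drift :: "real \<Rightarrow> real \<Rightarrow> (real \<Rightarrow> real) set" where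
  "skorokhod_drift T b = {(\<lambda>t. \<xi> t + b * t) | \<xi>. \<xi> \<in> skorokhod_incr T}"

definition time_changes :: "real \<Rightarrow> (real \<Rightarrow> real) set" where
  "time_changes T =
     {l. strict_mono_on {0..T} l \<and> (\<exists>m. homeomorphism {0..T} {0..T} l m)}"

definition dist_J1 :: "real \<Rightarrow> (real \<Rightarrow> real) \<Rightarrow> (real \<Rightarrow> real) \<Rightarrow> real" where
  "dist_J1 T \<xi> \<zeta> =
     (INF l\<in>time_changes T.
        max (SUP t\<in>{0..T}. \<bar>\<xi> (l t) - \<zeta> t\<bar>) (SUP t\<in>{0..T}. \<bar>l t - t\<bar>))"

definition dist_prod ::
  "real \<Rightarrow> ('d::finite \<Rightarrow> real \<Rightarrow> real) \<Rightarrow> ('d \<Rightarrow> real \<Rightarrow> real) \<Rightarrow> real" where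
  "dist_prod T \<xi> \<zeta> = (\<Sum>i\<in>UNIV. dist_J1 T (\<xi> i) (\<zeta> i))"

text \<open>
  Iterated matrix multiplication; the type-class power \<open>Q ^ n\<close> would be taken entrywise.
\<close>

definition matrix_power :: "real^'d^'d \<Rightarrow> nat \<Rightarrow> real^'d^'d" where
  "matrix_power Q n = (((**) Q) ^^ n) (mat 1)"

definition reflection_matrix :: "real^'d^'d \<Rightarrow> real^'d^'d" where
  "reflection_matrix Q = mat 1 - transpose Q"

definition apply_matrix ::
  "real^'d^'d \<Rightarrow> ('d::finite \<Rightarrow> real \<Rightarrow> real) \<Rightarrow> 'd \<Rightarrow> real \<Rightarrow> real" where
  "apply_matrix A \<zeta> = (\<lambda>i t. (A *v (\<chi> j. \<zeta> j t)) $ i)"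

definition feasible_regulators ::
  "real \<Rightarrow> real^'d^'d \<Rightarrow> ('d::finite \<Rightarrow> real \<Rightarrow> real) \<Rightarrow> ('d \<Rightarrow> real \<Rightarrow> real) set" where
  "feasible_regulators T Q \<xi> =
     {\<zeta> \<in> (\<Pi> i\<in>UNIV. skorokhod_incr T).
        \<forall>i. \<forall>t\<in>{0..T}. 0 \<le> \<xi> i t + apply_matrix (reflection_matrix Q) \<zeta> i t}"

definition regulator ::
  "real \<Rightarrow> real^'d^'d \<Rightarrow> ('d::finite \<Rightarrow> real \<Rightarrow> real) \<Rightarrow> 'd \<Rightarrow> real \<Rightarrow> real" where
  "regulator T Q \<xi> = (\<lambda>i t. INF \<omega>\<in>feasible_regulators T Q \<xi>. \<omega> i t)"

definition content_map ::
  "real \<Rightarrow> real^'d^'d \<Rightarrow> ('d::finite \<Rightarrow> real \<Rightarrow> real) \<Rightarrow> 'd \<Rightarrow> real \<Rightarrow> real" where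
  "content_map T Q \<xi> =
     (\<lambda>i t. \<xi> i t + apply_matrix (reflection_matrix Q) (regulator T Q \<xi>) i t)"

text \<open>
  The analogue of the library's \<^const>\<open>Lipschitz_continuous_map\<close>, with explicit carriers and
  distance functions. That constant itself is not applicable: distinct total functions that
  agree on \<open>{0..T}\<close> are at distance zero, so the distances here are only pseudometrics.
\<close>

definition lipschitz_map ::
  "'a set \<Rightarrow> ('a \<Rightarrow> 'a \<Rightarrow> real) \<Rightarrow> 'b set \<Rightarrow> ('b \<Rightarrow> 'b \<Rightarrow> real) \<Rightarrow> ('a \<Rightarrow> 'b) \<Rightarrow> bool" where
  "lipschitz_map X dX Y dY f \<longleftrightarrow>
     f \<in> X \<rightarrow> Y \<and> (\<exists>L\<ge>0. \<forall>x\<in>X. \<forall>y\<in>X. dY (f x) (f y) \<le> L * dX x y)"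

end

theory Submission
  imports Defs
begin

text \<open>
  Write \<open>\<Q> = I - Q\<^sup>T\<close>, let \<open>b\<close> bound the \<open>\<bar>\<beta>\<^sub>i\<bar>\<close>, and fix \<open>v \<ge> 0\<close> with \<open>\<Q> v \<ge> 1\<close>; such a
  \<open>v\<close> exists because \<open>Q\<^sup>n \<rightarrow> 0\<close>. Everything rests on one way of moving a feasible regulator from
  one path to another (\<open>feasible_transfer\<close>): if \<open>\<zeta>\<^sub>i t \<ge> \<xi>\<^sub>i (g t) - h t\<close> for all \<open>i\<close> and \<open>t\<close>,
  with the \<^emph>\<open>same\<close> increasing continuous substitution \<open>g\<close> of \<open>[0,T]\<close> and the same increasing
  correction \<open>h \<ge> 0\<close> in every coordinate, and if \<open>\<omega>\<close> is feasible for \<open>\<xi>\<close>, then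
  \<open>\<omega> \<circ> g + h v\<close> is feasible for \<open>\<zeta>\<close>.

  The \<open>J\<^sub>1\<close> distances of the coordinates are approached by different time changes, and here
  the shape of the paths enters. Let each coordinate be an increasing path plus a linear drift,
  and let \<open>\<epsilon>\<close> exceed \<open>d\<^sub>p(\<xi>, \<zeta>)\<close>. Each coordinate has its own time change within \<open>\<epsilon>\<close> of the
  identity; by monotonicity, replacing it by the pure delay \<open>t \<mapsto> max 0 (t - \<epsilon>)\<close> only lowers the
  increasing part, and it changes the drift by at most \<open>2 b \<epsilon>\<close>. So
  \<open>\<zeta>\<^sub>i t \<ge> \<xi>\<^sub>i (max 0 (t - \<epsilon>)) - (1 + 2 b) \<epsilon>\<close> for all \<open>i\<close> at once, and the transfer yields
  \<open>\<psi>(\<zeta>) \<le> \<psi>(\<xi>) + (1 + 2 b) \<epsilon> v\<close>. By symmetry \<open>\<psi>\<close> is Lipschitz from \<open>d\<^sub>p\<close> even to the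
  uniform distance (\<open>regulator_uniform_estimate\<close>).

  For the content map the time change of the \<open>i\<close>-th coordinate of the input can be kept for the
  \<open>i\<close>-th coordinate of the output, because the regulator is itself Lipschitz in time
  (\<open>regulator_Lipschitz_in_time\<close>): a path in the domain has no downward jumps and decreases at
  rate at most \<open>b\<close>, so a regulator that is frozen at time \<open>s\<close> stays feasible after \<open>s\<close> once it is
  allowed to grow at rate \<open>b v\<close>.
\<close>

section \<open>A vector that the reflection matrix maps above one\<close>

lemma matrix_power_0: "matrix_power Q 0 = mat 1"
  by (simp add: matrix_power_def)

lemma matrix_power_Suc: "matrix_power Q (Suc n) = Q ** matrix_power Q n"
  by (simp add: matrix_power_def)

lemma matrix_power_Suc_right: "matrix_power Q (Suc n) = matrix_power Q n ** Q"
proof (induction n)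
  case 0
  then show ?case by (simp add: matrix_power_0 matrix_power_Suc)
next
  case (Suc n)
  have "matrix_power Q (Suc (Suc n)) = Q ** (matrix_power Q n ** Q)"
    using Suc by (simp only: matrix_power_Suc[of Q "Suc n"])
  then show ?case
    by (simp add: matrix_power_Suc matrix_mul_assoc)
qed

lemma matrix_power_nonneg:
  fixes Q :: "real^'d^'d"
  assumes "\<forall>i j. 0 \<le> Q $ i $ j"
  shows "0 \<le> matrix_power Q n $ i $ j"
proof (induction n arbitrary: i j)
  case 0
  then show ?case by (simp add: matrix_power_0 mat_def)
next
  case (Suc n)
  then show ?case
    using assms by (auto simp: matrix_power_Suc matrix_matrix_mult_def intro!: sum_nonneg)
qed

text \<open>
  The witness is twice a partial sum \<open>\<Sum>k<N. (Q\<^sup>T)\<^sup>k 1\<close> of the Neumann series of the inverse of the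
  reflection matrix. The reflection matrix telescopes the partial sum to \<open>1 - (Q\<^sup>T)\<^sup>N 1\<close>, which
  is at least one half when \<open>N\<close> is large.
\<close>

lemma reflection_matrix_witness:
  fixes Q :: "real^'d^'d"
  assumes nonneg: "\<forall>i j. 0 \<le> Q $ i $ j"
    and lim: "(\<lambda>n. matrix_power Q n) \<longlonglongrightarrow> 0"
  obtains v :: "real^'d"
  where "\<And>i. 0 \<le> v $ i" "\<And>i. 1 \<le> (reflection_matrix Q *v v) $ i"
proof -
  define w :: "nat \<Rightarrow> real^'d" where "w n = transpose (matrix_power Q n) *v 1" for n
  have w_nth: "w n $ i = (\<Sum>j\<in>UNIV. matrix_power Q n $ j $ i)" for n i
    by (simp add: w_def matrix_vector_mult_def transpose_def)
  have w_nonneg: "0 \<le> w n $ i" for n i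
    unfolding w_nth using matrix_power_nonneg[OF nonneg] by (intro sum_nonneg) auto
  have w_0: "w 0 = 1"
    by (simp add: w_def matrix_power_0)
  have step: "reflection_matrix Q *v w n = w n - w (Suc n)" for n
    unfolding w_def reflection_matrix_def matrix_power_Suc_right matrix_transpose_mul
    by (simp only: matrix_vector_mult_diff_rdistrib matrix_vector_mul_lid
        matrix_vector_mul_assoc[symmetric])
  have "(\<lambda>n. w n $ i) \<longlonglongrightarrow> 0" for i
  proof -
    have "(\<lambda>n. \<Sum>j\<in>UNIV. matrix_power Q n $ j $ i) \<longlonglongrightarrow> (\<Sum>j\<in>(UNIV::'d set). (0::real^'d^'d) $ j $ i)"
      by (intro tendsto_sum tendsto_vec_nth lim)
    then show ?thesis by (simp add: w_nth)
  qed
  then have "\<forall>\<^sub>F n in sequentially. w n $ i < 1/2" for i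
    by (rule order_tendstoD) simp
  then have "\<forall>\<^sub>F n in sequentially. \<forall>i. w n $ i < 1/2"
    by (simp add: eventually_all_finite)
  then obtain N where N: "\<And>i. w N $ i < 1/2"
    by (auto simp: eventually_sequentially)
  define v where "v = 2 *\<^sub>R (\<Sum>k<N. w k)"
  have telescope: "reflection_matrix Q *v (\<Sum>k<n. w k) = 1 - w n" for n
    by (induction n) (simp_all add: w_0 step matrix_vector_right_distrib)
  show thesis
  proof
    show "0 \<le> v $ i" for i
      by (auto simp: v_def intro!: sum_nonneg w_nonneg)
    have "(reflection_matrix Q *v v) $ i = 2 * (1 - w N $ i)" for i
      by (simp add: v_def matrix_vector_mult_scaleR telescope)
    then show "1 \<le> (reflection_matrix Q *v v) $ i" for i
      using N[of i] by simp
  qed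
qed

lemma apply_matrix_eq_sum: "apply_matrix A \<zeta> i t = (\<Sum>j\<in>UNIV. A $ i $ j * \<zeta> j t)"
  by (simp add: apply_matrix_def matrix_vector_mult_def)

section \<open>Monotone paths, and paths with a drift\<close>

text \<open>
  For a monotone path the existence of left limits is automatic, so that only right continuity
  has to be checked.
\<close>

lemma skorokhod_incr_iff:
  "\<xi> \<in> skorokhod_incr T \<longleftrightarrow>
     mono_on {0..T} \<xi> \<and> 0 \<le> \<xi> 0 \<and> (\<forall>t\<in>{0..<T}. continuous (at_right t) \<xi>)"
proof -
  have "\<exists>l. (\<xi> \<longlongrightarrow> l) (at_left t)" if mono: "mono_on {0..T} \<xi>" and t: "t \<in> {0<..T}" for t
  proof -
    have eq: "at t within ({..<t} \<inter> {0..T}) = at_left t"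
      by (rule at_within_nhd[of _ "{0<..}"]) (use t in auto)
    have "(\<xi> \<longlongrightarrow> Sup (\<xi> ` ({..<t} \<inter> {0..T}))) (at t within ({..<t} \<inter> {0..T}))"
      by (rule Lim_left_bound[where K = "\<xi> t"])
         (use t in \<open>auto intro!: mono_onD[OF mono]\<close>)
    then show ?thesis unfolding eq by blast
  qed
  then show ?thesis
    by (auto simp: skorokhod_incr_def skorokhod_def cadlag_on_def continuous_within)
qed

lemma skorokhod_incr_nonneg:
  assumes "\<xi> \<in> skorokhod_incr T" "t \<in> {0..T}"
  shows "0 \<le> \<xi> t"
  using assms mono_onD[of "{0..T}" \<xi> 0 t] by (fastforce simp: skorokhod_incr_iff)

lemma skorokhod_incr_compose:
  assumes "\<omega> \<in> skorokhod_incr T" "mono_on {0..T} g" "continuous_on {0..T} g"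
    "g ` {0..T} \<subseteq> {0..T}" "0 < T"
  shows "(\<lambda>t. \<omega> (g t)) \<in> skorokhod_incr T"
  unfolding skorokhod_incr_iff
proof (intro conjI ballI)
  have mono: "mono_on {0..T} \<omega>" and right: "\<And>t. t \<in> {0..<T} \<Longrightarrow> continuous (at_right t) \<omega>"
    using assms(1) by (auto simp: skorokhod_incr_iff)
  have range: "g t \<in> {0..T}" if "t \<in> {0..T}" for t
    using assms(4) that by blast
  show "mono_on {0..T} (\<lambda>t. \<omega> (g t))"
    by (intro mono_onI mono_onD[OF mono] range mono_onD[OF assms(2)]) auto
  show "0 \<le> \<omega> (g 0)"
    using \<open>0 < T\<close> by (intro skorokhod_incr_nonneg[OF assms(1)] range) auto
  fix t assume t: "t \<in> {0..<T}"
  then have sub: "g ` {t..T} \<subseteq> {g t..T}"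
    using range by (auto intro!: mono_onD[OF assms(2)])
  \<comment> \<open>Nothing is known about \<open>\<omega>\<close> to the right of \<open>T\<close>, so continuity is taken within \<open>{g t..T}\<close>,
    which is a single point if \<open>g\<close> has already reached \<open>T\<close>.\<close>
  have "continuous (at (g t) within {g t..T}) \<omega>"
  proof (cases "g t = T")
    case True
    then show ?thesis by (auto simp: continuous_within_topological)
  next
    case False
    with range[of t] t have "g t \<in> {0..<T}" by auto
    with right show ?thesis by (simp add: at_within_Icc_at_right)
  qed
  then have "continuous (at (g t) within g ` {t..T}) \<omega>"
    by (rule continuous_within_subset) (rule sub)
  moreover have "continuous (at t within {t..T}) g"
    using assms(3) t by (meson atLeastAtMost_iff atLeastLessThan_iff atLeastatMost_subset_iff
        continuous_on_eq_continuous_within continuous_within_subset less_imp_le order_refl)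
  ultimately show "continuous (at_right t) (\<lambda>t. \<omega> (g t))"
    using continuous_within_compose2[of t "{t..T}" g \<omega>] t
    by (simp add: at_within_Icc_at_right)
qed

lemma skorokhod_incr_add:
  assumes "\<xi> \<in> skorokhod_incr T" "\<zeta> \<in> skorokhod_incr T"
  shows "(\<lambda>t. \<xi> t + \<zeta> t) \<in> skorokhod_incr T"
  using assms by (auto simp: skorokhod_incr_iff intro!: continuous_add mono_onI add_mono
      dest: mono_onD)

lemma skorokhod_incr_mult_right:
  assumes "\<xi> \<in> skorokhod_incr T" "0 \<le> c"
  shows "(\<lambda>t. \<xi> t * c) \<in> skorokhod_incr T"
  using assms by (auto simp: skorokhod_incr_iff intro!: continuous_intros mono_onI mult_right_mono
      dest: mono_onD)

lemma skorokhod_incr_of_continuous: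
  assumes "mono_on {0..T} h" "0 \<le> h 0" "continuous_on UNIV h"
  shows "h \<in> skorokhod_incr T"
  using assms by (auto simp: skorokhod_incr_iff continuous_on_eq_continuous_within
      intro: continuous_at_imp_continuous_at_within)

lemma skorokhodI_continuous:
  assumes "continuous_on {0..T} \<xi>"
  shows "\<xi> \<in> skorokhod T"
  unfolding skorokhod_def cadlag_on_def
proof (safe intro!: exI)
  show "(\<xi> \<longlongrightarrow> \<xi> t) (at_right t)" if "t \<in> {0..<T}" for t
    by (rule continuous_on_Icc_at_rightD[of t T])
       (use that in \<open>auto intro: continuous_on_subset[OF assms]\<close>)
  show "(\<xi> \<longlongrightarrow> \<xi> t) (at_left t)" if "t \<in> {0<..T}" for t
    by (rule continuous_on_Icc_at_leftD[of 0 t])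
       (use that in \<open>auto intro: continuous_on_subset[OF assms]\<close>)
qed

lemma skorokhod_add:
  assumes "\<xi> \<in> skorokhod T" "\<zeta> \<in> skorokhod T"
  shows "(\<lambda>t. \<xi> t + \<zeta> t) \<in> skorokhod T"
  using assms unfolding skorokhod_def cadlag_on_def by (blast intro: tendsto_add)

lemma skorokhod_drift_subset: "skorokhod_drift T b \<subseteq> skorokhod T"
proof
  fix \<xi> assume "\<xi> \<in> skorokhod_drift T b"
  then obtain x where "\<xi> = (\<lambda>t. x t + b * t)" "x \<in> skorokhod_incr T"
    by (auto simp: skorokhod_drift_def)
  moreover have "(\<lambda>t. b * t) \<in> skorokhod T"
    by (intro skorokhodI_continuous continuous_intros)
  ultimately show "\<xi> \<in> skorokhod T"
    by (simp add: skorokhod_incr_def skorokhod_add)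
qed

lemma skorokhod_drift_bounded:
  assumes "\<xi> \<in> skorokhod_drift T b"
  shows "bounded (\<xi> ` {0..T})"
proof -
  obtain x where x: "\<xi> = (\<lambda>t. x t + b * t)" "x \<in> skorokhod_incr T"
    using assms by (auto simp: skorokhod_drift_def)
  have "x ` {0..T} \<subseteq> {x 0..x T}"
    using x by (auto simp: skorokhod_incr_iff intro!: mono_onD[of "{0..T}" x])
  then have "bounded (x ` {0..T})"
    by (meson bounded_closed_interval bounded_subset)
  moreover have "bounded ((\<lambda>t. b * t) ` {0..T})"
    by (intro compact_imp_bounded compact_continuous_image continuous_intros) auto
  ultimately show ?thesis
    unfolding x by (rule bounded_plus_comp)
qed

text \<open>Such a path can decrease only through its drift.\<close>

lemma skorokhod_drift_decrease:
  assumes "\<xi> \<in> skorokhod_drift T \<beta>" "\<bar>\<beta>\<bar> \<le> b" "0 \<le> r" "r \<le> s" "s \<le> T"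
  shows "\<xi> r \<le> \<xi> s + b * (s - r)"
proof -
  obtain x where x: "\<xi> = (\<lambda>t. x t + \<beta> * t)" "x \<in> skorokhod_incr T"
    using assms by (auto simp: skorokhod_drift_def)
  have "x r \<le> x s"
    using x assms by (intro mono_onD[of "{0..T}" x]) (auto simp: skorokhod_incr_iff)
  moreover have "(- \<beta>) * (s - r) \<le> b * (s - r)"
    using assms by (intro mult_right_mono) auto
  ultimately show ?thesis
    by (simp add: x algebra_simps)
qed

section \<open>The \<open>J\<^sub>1\<close> distance\<close>

lemma time_changes_maps_to: "l \<in> time_changes T \<Longrightarrow> t \<in> {0..T} \<Longrightarrow> l t \<in> {0..T}"
  by (auto simp: time_changes_def homeomorphism_def)

lemma id_in_time_changes: "(\<lambda>t. t) \<in> time_changes T"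
  by (auto simp: time_changes_def homeomorphism_def strict_mono_on_def
      intro!: exI[of _ "\<lambda>t. t"])

lemma time_change_displacement_bdd:
  assumes "l \<in> time_changes T"
  shows "bdd_above ((\<lambda>t. \<bar>l t - t\<bar>) ` {0..T})"
  by (rule bdd_aboveI2[of _ _ T]) (use time_changes_maps_to[OF assms] in fastforce)

lemma J1_displacement_nonneg:
  assumes "0 \<le> T" "l \<in> time_changes T"
  shows "0 \<le> (SUP t\<in>{0..T}. \<bar>l t - t\<bar>)"
  by (rule cSUP_upper2[OF time_change_displacement_bdd[OF assms(2)], of 0]) (use assms in auto)

lemma J1_objective_bdd_below:
  assumes "0 \<le> T"
  shows "bdd_below ((\<lambda>l. max (SUP t\<in>{0..T}. \<bar>\<xi> (l t) - \<zeta> t\<bar>) (SUP t\<in>{0..T}. \<bar>l t - t\<bar>))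
           ` time_changes T)"
  using J1_displacement_nonneg[OF assms] by (intro bdd_belowI2[of _ 0]) (simp add: le_max_iff_disj)

lemma dist_J1_nonneg:
  assumes "0 \<le> T"
  shows "0 \<le> dist_J1 T \<xi> \<zeta>"
  unfolding dist_J1_def using id_in_time_changes J1_displacement_nonneg[OF assms]
  by (intro cINF_greatest) (auto simp: le_max_iff_disj)

lemma dist_J1_le:
  assumes "0 \<le> T" "l \<in> time_changes T"
    and "\<And>t. t \<in> {0..T} \<Longrightarrow> \<bar>\<xi> (l t) - \<zeta> t\<bar> \<le> c" "\<And>t. t \<in> {0..T} \<Longrightarrow> \<bar>l t - t\<bar> \<le> c"
  shows "dist_J1 T \<xi> \<zeta> \<le> c"
  unfolding dist_J1_def
  by (rule cINF_lower2[OF J1_objective_bdd_below assms(2)])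
     (use assms in \<open>auto intro!: cSUP_least\<close>)

lemma dist_J1_lessE:
  assumes "dist_J1 T \<xi> \<zeta> < e" "bounded (\<xi> ` {0..T})" "bounded (\<zeta> ` {0..T})"
  obtains l where "l \<in> time_changes T"
    "\<And>t. t \<in> {0..T} \<Longrightarrow> \<bar>\<xi> (l t) - \<zeta> t\<bar> \<le> e" "\<And>t. t \<in> {0..T} \<Longrightarrow> \<bar>l t - t\<bar> \<le> e"
proof -
  obtain l where l: "l \<in> time_changes T"
    and less: "(SUP t\<in>{0..T}. \<bar>\<xi> (l t) - \<zeta> t\<bar>) < e" "(SUP t\<in>{0..T}. \<bar>l t - t\<bar>) < e"
    using cInf_lessD[OF _ assms(1)[unfolded dist_J1_def]] id_in_time_changes by fastforce
  have "bounded ((\<lambda>t. \<xi> (l t)) ` {0..T})"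
    by (rule bounded_subset[OF assms(2)]) (use time_changes_maps_to[OF l] in auto)
  then have "bounded ((\<lambda>t. \<xi> (l t) - \<zeta> t) ` {0..T})"
    using assms(3) by (rule bounded_minus_comp)
  then have bdd: "bdd_above ((\<lambda>t. \<bar>\<xi> (l t) - \<zeta> t\<bar>) ` {0..T})"
    by (auto simp: bounded_iff bdd_above_def)
  show thesis
  proof (rule that[OF l])
    show "\<bar>\<xi> (l t) - \<zeta> t\<bar> \<le> e" if "t \<in> {0..T}" for t
      using cSUP_upper[OF that bdd] less by linarith
    show "\<bar>l t - t\<bar> \<le> e" if "t \<in> {0..T}" for t
      using cSUP_upper[OF that time_change_displacement_bdd[OF l]] less by linarith
  qed
qed

text \<open>
  The delayed time lies below \<open>s\<close> by at most \<open>2 e\<close>, so the increasing part of the path only helps.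
\<close>

lemma skorokhod_drift_delay:
  assumes "\<xi> \<in> skorokhod_drift T \<beta>" "\<bar>\<beta>\<bar> \<le> b" "s \<in> {0..T}" "t \<in> {0..T}" "\<bar>s - t\<bar> \<le> e"
  shows "\<xi> (max 0 (t - e)) \<le> \<xi> s + 2 * b * e"
proof -
  have "\<xi> (max 0 (t - e)) \<le> \<xi> s + b * (s - max 0 (t - e))"
    using assms by (intro skorokhod_drift_decrease[of _ T \<beta>]) auto
  moreover have "b * (s - max 0 (t - e)) \<le> b * (2 * e)"
    using assms by (intro mult_left_mono) auto
  ultimately show ?thesis by simp
qed

text \<open>
  This removes the time change from a \<open>J\<^sub>1\<close> estimate at the price of a delay that depends only on
  the distance, and hence can be shared by all coordinates of a multidimensional path. Both
  comparisons come from the same time change: the second one evaluates it at the preimage of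
  \<open>t\<close>.
\<close>

lemma dist_J1_less_imp_delayed_le:
  assumes "\<xi> \<in> skorokhod_drift T \<beta>" "\<zeta> \<in> skorokhod_drift T \<beta>" "\<bar>\<beta>\<bar> \<le> b"
    "dist_J1 T \<xi> \<zeta> < e" "t \<in> {0..T}"
  shows "\<xi> (max 0 (t - e)) - (1 + 2 * b) * e \<le> \<zeta> t"
    and "\<zeta> (max 0 (t - e)) - (1 + 2 * b) * e \<le> \<xi> t"
proof -
  obtain l where l: "l \<in> time_changes T"
    and near: "\<And>t. t \<in> {0..T} \<Longrightarrow> \<bar>\<xi> (l t) - \<zeta> t\<bar> \<le> e" "\<And>t. t \<in> {0..T} \<Longrightarrow> \<bar>l t - t\<bar> \<le> e"
    using dist_J1_lessE[OF assms(4)] assms(1,2) skorokhod_drift_bounded by metis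
  have "\<xi> (max 0 (t - e)) \<le> \<xi> (l t) + 2 * b * e"
    using time_changes_maps_to[OF l assms(5)] near(2)[OF assms(5)]
    by (intro skorokhod_drift_delay[OF assms(1,3) _ assms(5)]) auto
  with near(1)[OF assms(5)] show "\<xi> (max 0 (t - e)) - (1 + 2 * b) * e \<le> \<zeta> t"
    by (simp add: algebra_simps)
  have "l ` {0..T} = {0..T}"
    using l by (auto simp: time_changes_def homeomorphism_def)
  then obtain u where u: "u \<in> {0..T}" "l u = t"
    using assms(5) by (metis imageE)
  have "\<zeta> (max 0 (t - e)) \<le> \<zeta> u + 2 * b * e"
    using near(2)[OF u(1)] u
    by (intro skorokhod_drift_delay[OF assms(2,3) _ assms(5)]) auto
  with near(1)[OF u(1)] u(2) show "\<zeta> (max 0 (t - e)) - (1 + 2 * b) * e \<le> \<xi> t"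
    by (simp add: algebra_simps)
qed

section \<open>Transfer of feasible regulators\<close>

lemma feasible_transfer:
  fixes v :: "real^'d"
  assumes v: "\<And>i. 0 \<le> v $ i" "\<And>i. 1 \<le> (reflection_matrix Q *v v) $ i" and "0 < T"
    and g: "mono_on {0..T} g" "continuous_on {0..T} g" "g ` {0..T} \<subseteq> {0..T}"
    and h: "h \<in> skorokhod_incr T"
    and le: "\<And>i t. t \<in> {0..T} \<Longrightarrow> \<xi> i (g t) - h t \<le> \<zeta> i t"
    and \<omega>: "\<omega> \<in> feasible_regulators T Q \<xi>"
  shows "(\<lambda>i t. \<omega> i (g t) + h t * v $ i) \<in> feasible_regulators T Q \<zeta>"
  unfolding feasible_regulators_def
proof (intro CollectI conjI allI ballI Pi_I)
  show "(\<lambda>t. \<omega> i (g t) + h t * v $ i) \<in> skorokhod_incr T" for i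
  proof (rule skorokhod_incr_add)
    have "\<omega> i \<in> skorokhod_incr T"
      using \<omega> by (auto simp: feasible_regulators_def)
    then show "(\<lambda>t. \<omega> i (g t)) \<in> skorokhod_incr T"
      using g \<open>0 < T\<close> by (rule skorokhod_incr_compose)
    show "(\<lambda>t. h t * v $ i) \<in> skorokhod_incr T"
      using h v(1) by (rule skorokhod_incr_mult_right)
  qed
  fix i t assume t: "t \<in> {0..T}"
  have "0 \<le> \<xi> i (g t) + apply_matrix (reflection_matrix Q) \<omega> i (g t)"
    using \<omega> g(3) t by (simp add: feasible_regulators_def image_subset_iff)
  also have "\<dots> \<le> \<zeta> i t + h t + apply_matrix (reflection_matrix Q) \<omega> i (g t)"
    using le[OF t, of i] by simp
  also have "\<dots> \<le> \<zeta> i t + h t * (reflection_matrix Q *v v) $ i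
      + apply_matrix (reflection_matrix Q) \<omega> i (g t)"
    using mult_left_mono[OF v(2)[of i] skorokhod_incr_nonneg[OF h t]] by simp
  finally show "0 \<le> \<zeta> i t
      + apply_matrix (reflection_matrix Q) (\<lambda>i t. \<omega> i (g t) + h t * v $ i) i t"
    by (simp add: apply_matrix_eq_sum matrix_vector_mult_def sum.distrib sum_distrib_left
        algebra_simps)
qed

lemma feasible_regulators_bdd_below:
  assumes "t \<in> {0..T}"
  shows "bdd_below ((\<lambda>\<omega>. \<omega> i t) ` feasible_regulators T Q \<xi>)"
proof (rule bdd_belowI2)
  fix \<omega> assume "\<omega> \<in> feasible_regulators T Q \<xi>"
  then have "\<omega> i \<in> skorokhod_incr T"
    by (auto simp: feasible_regulators_def)
  then show "0 \<le> \<omega> i t"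
    using assms by (rule skorokhod_incr_nonneg)
qed

lemma regulator_le:
  assumes "\<omega> \<in> feasible_regulators T Q \<xi>" "t \<in> {0..T}"
  shows "regulator T Q \<xi> i t \<le> \<omega> i t"
  unfolding regulator_def by (rule cINF_lower[OF feasible_regulators_bdd_below]) (use assms in auto)

lemma regulator_transfer:
  fixes v :: "real^'d"
  assumes v: "\<And>i. 0 \<le> v $ i" "\<And>i. 1 \<le> (reflection_matrix Q *v v) $ i" and "0 < T"
    and g: "mono_on {0..T} g" "continuous_on {0..T} g" "g ` {0..T} \<subseteq> {0..T}"
    and h: "h \<in> skorokhod_incr T"
    and le: "\<And>i t. t \<in> {0..T} \<Longrightarrow> \<xi> i (g t) - h t \<le> \<zeta> i t"
    and ne: "feasible_regulators T Q \<xi> \<noteq> {}"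
    and t: "t \<in> {0..T}"
  shows "regulator T Q \<zeta> i t \<le> regulator T Q \<xi> i (g t) + h t * v $ i"
proof -
  have "regulator T Q \<zeta> i t - h t * v $ i \<le> \<omega> i (g t)" if "\<omega> \<in> feasible_regulators T Q \<xi>" for \<omega>
    using regulator_le[OF feasible_transfer[OF v \<open>0 < T\<close> g h le that] t, where i = i] by simp
  then have "regulator T Q \<zeta> i t - h t * v $ i \<le> regulator T Q \<xi> i (g t)"
    unfolding regulator_def[of T Q \<xi>] by (intro cINF_greatest ne)
  then show ?thesis by simp
qed

lemma regulator_mono:
  assumes "feasible_regulators T Q \<xi> \<noteq> {}" "r \<in> {0..T}" "s \<in> {0..T}" "r \<le> s"
  shows "regulator T Q \<xi> i r \<le> regulator T Q \<xi> i s"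
  unfolding regulator_def
proof (rule cINF_mono)
  fix \<omega> assume "\<omega> \<in> feasible_regulators T Q \<xi>"
  then have "mono_on {0..T} (\<omega> i)"
    by (auto simp: feasible_regulators_def skorokhod_incr_iff Pi_iff)
  then have "\<omega> i r \<le> \<omega> i s"
    using assms(2-4) by (rule mono_onD)
  with \<open>\<omega> \<in> feasible_regulators T Q \<xi>\<close>
  show "\<exists>\<omega>'\<in>feasible_regulators T Q \<xi>. \<omega>' i r \<le> \<omega> i s"
    by blast
qed (rule assms(1) feasible_regulators_bdd_below[OF assms(2)])+

section \<open>Estimates for the regulator and the content\<close>

text \<open>
  A path in the domain lies above \<open>- b t\<close>, so the regulator \<open>b t v\<close> keeps it nonnegative: this is
  the transfer of the zero regulator from the zero path.
\<close>

lemma feasible_regulators_nonempty: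
  fixes v \<beta> :: "real^'d"
  assumes v: "\<And>i. 0 \<le> v $ i" "\<And>i. 1 \<le> (reflection_matrix Q *v v) $ i" and "0 < T"
    and \<xi>: "\<xi> \<in> (\<Pi> i\<in>UNIV. skorokhod_drift T (\<beta> $ i))" and b: "\<And>i. \<bar>\<beta> $ i\<bar> \<le> b"
  shows "feasible_regulators T Q \<xi> \<noteq> {}"
proof -
  have "0 \<le> b" using b[of undefined] by linarith
  have "(\<lambda>i t. (\<lambda>i t. 0) i t + b * t * v $ i) \<in> feasible_regulators T Q \<xi>"
  proof (rule feasible_transfer[OF v \<open>0 < T\<close>, where g = "\<lambda>t. t" and \<xi> = "\<lambda>i t. 0"])
    show "(\<lambda>t. b * t) \<in> skorokhod_incr T"
      using \<open>0 \<le> b\<close>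
      by (intro skorokhod_incr_of_continuous mono_onI continuous_intros) (auto intro: mult_left_mono)
    fix i t assume t: "t \<in> {0..T}"
    obtain x where x: "\<xi> i = (\<lambda>t. x t + \<beta> $ i * t)" "x \<in> skorokhod_incr T"
      using \<xi> by (fastforce simp: skorokhod_drift_def Pi_iff)
    have "(- (\<beta> $ i)) * t \<le> b * t"
      using b[of i] t by (intro mult_right_mono) auto
    then show "0 - b * t \<le> \<xi> i t"
      using skorokhod_incr_nonneg[OF x(2) t] by (simp add: x)
  qed (auto simp: feasible_regulators_def apply_matrix_eq_sum skorokhod_incr_iff mono_on_def
      continuous_on_id)
  then show ?thesis by blast
qed

text \<open>Here the transfer goes from a path to itself, with time stopped at \<open>s\<close>.\<close>

lemma regulator_Lipschitz_in_time:
  fixes v \<beta> :: "real^'d"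
  assumes v: "\<And>i. 0 \<le> v $ i" "\<And>i. 1 \<le> (reflection_matrix Q *v v) $ i" and "0 < T"
    and \<xi>: "\<xi> \<in> (\<Pi> i\<in>UNIV. skorokhod_drift T (\<beta> $ i))" and b: "\<And>i. \<bar>\<beta> $ i\<bar> \<le> b"
    and "s \<in> {0..T}" "t \<in> {0..T}"
  shows "\<bar>regulator T Q \<xi> i s - regulator T Q \<xi> i t\<bar> \<le> b * v $ i * \<bar>s - t\<bar>"
proof -
  note ne = feasible_regulators_nonempty[OF v \<open>0 < T\<close> \<xi> b]
  have "0 \<le> b" using b[of undefined] by linarith
  have forward: "regulator T Q \<xi> i t \<le> regulator T Q \<xi> i s + b * v $ i * (t - s)"
    if s: "s \<in> {0..T}" and t: "t \<in> {0..T}" and "s \<le> t" for s t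
  proof -
    have "regulator T Q \<xi> i t \<le> regulator T Q \<xi> i (min t s) + b * max 0 (t - s) * v $ i"
    proof (rule regulator_transfer[OF v \<open>0 < T\<close> _ _ _ _ _ ne t])
      show "(\<lambda>t. b * max 0 (t - s)) \<in> skorokhod_incr T"
        using \<open>0 \<le> b\<close> by (intro skorokhod_incr_of_continuous mono_onI continuous_intros)
          (auto intro!: mult_left_mono)
      show "\<xi> j (min u s) - b * max 0 (u - s) \<le> \<xi> j u" if "u \<in> {0..T}" for j u
        using skorokhod_drift_decrease[of "\<xi> j" T "\<beta> $ j" b "min u s" u] \<xi> b[of j] that s
        by (cases "u \<le> s") (auto simp: Pi_iff)
    qed (use s in \<open>auto intro!: mono_onI continuous_intros\<close>)
    with \<open>s \<le> t\<close> show ?thesis by (simp add: algebra_simps)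
  qed
  show ?thesis
    using forward[of s t] forward[of t s] assms(6,7)
      regulator_mono[OF ne, of s t i] regulator_mono[OF ne, of t s i]
    by (cases "s \<le> t") (auto simp: abs_if algebra_simps)
qed

lemma regulator_uniform_estimate:
  fixes v \<beta> :: "real^'d"
  assumes v: "\<And>i. 0 \<le> v $ i" "\<And>i. 1 \<le> (reflection_matrix Q *v v) $ i" and "0 < T"
    and \<xi>: "\<xi> \<in> (\<Pi> i\<in>UNIV. skorokhod_drift T (\<beta> $ i))"
    and \<zeta>: "\<zeta> \<in> (\<Pi> i\<in>UNIV. skorokhod_drift T (\<beta> $ i))" and b: "\<And>i. \<bar>\<beta> $ i\<bar> \<le> b"
    and close: "\<And>i. dist_J1 T (\<xi> i) (\<zeta> i) < e"
    and t: "t \<in> {0..T}"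
  shows "\<bar>regulator T Q \<xi> i t - regulator T Q \<zeta> i t\<bar> \<le> (1 + 2 * b) * e * v $ i"
proof -
  have "0 \<le> b" using b[of undefined] by linarith
  have "0 \<le> e"
    using close[of i] dist_J1_nonneg[of T "\<xi> i" "\<zeta> i"] \<open>0 < T\<close> by linarith
  have one_sided: "regulator T Q \<zeta> i t \<le> regulator T Q \<xi> i t + (1 + 2 * b) * e * v $ i"
    if \<xi>: "\<xi> \<in> (\<Pi> i\<in>UNIV. skorokhod_drift T (\<beta> $ i))"
      and le: "\<And>i t. t \<in> {0..T} \<Longrightarrow> \<xi> i (max 0 (t - e)) - (1 + 2 * b) * e \<le> \<zeta> i t" for \<xi> \<zeta>
  proof -
    note ne = feasible_regulators_nonempty[OF v \<open>0 < T\<close> \<xi> b]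
    have "regulator T Q \<zeta> i t \<le> regulator T Q \<xi> i (max 0 (t - e)) + (1 + 2 * b) * e * v $ i"
      by (rule regulator_transfer[OF v \<open>0 < T\<close> _ _ _ _ le ne t])
         (use \<open>0 \<le> b\<close> \<open>0 \<le> e\<close> \<open>0 < T\<close> in
           \<open>auto intro!: mono_onI continuous_intros skorokhod_incr_of_continuous\<close>)
    also have "regulator T Q \<xi> i (max 0 (t - e)) \<le> regulator T Q \<xi> i t"
      using t \<open>0 \<le> e\<close> by (intro regulator_mono ne) auto
    finally show ?thesis by simp
  qed
  have "\<xi> i \<in> skorokhod_drift T (\<beta> $ i)" "\<zeta> i \<in> skorokhod_drift T (\<beta> $ i)" for i
    using \<xi> \<zeta> by auto
  note delayed = dist_J1_less_imp_delayed_le[OF this b close]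
  show ?thesis
    using one_sided[OF \<xi> delayed(1)] one_sided[OF \<zeta> delayed(2)] by (simp add: abs_le_iff)
qed

lemma regulator_continuous_on:
  fixes v \<beta> :: "real^'d"
  assumes v: "\<And>i. 0 \<le> v $ i" "\<And>i. 1 \<le> (reflection_matrix Q *v v) $ i" and "0 < T"
    and \<xi>: "\<xi> \<in> (\<Pi> i\<in>UNIV. skorokhod_drift T (\<beta> $ i))" and b: "\<And>i. \<bar>\<beta> $ i\<bar> \<le> b"
  shows "continuous_on {0..T} (regulator T Q \<xi> i)"
proof -
  have "0 \<le> b" using b[of undefined] by linarith
  with v(1)[of i] have "(b * v $ i)-lipschitz_on {0..T} (regulator T Q \<xi> i)"
    using regulator_Lipschitz_in_time[OF v \<open>0 < T\<close> \<xi> b]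
    by (intro lipschitz_onI) (auto simp: dist_real_def)
  then show ?thesis by (rule lipschitz_on_continuous_on)
qed

text \<open>
  The output is compared along the time change of the same coordinate of the input. For the
  regulator term this costs one step in time and one step in the path.
\<close>

lemma content_J1_estimate:
  fixes v \<beta> :: "real^'d"
  assumes v: "\<And>i. 0 \<le> v $ i" "\<And>i. 1 \<le> (reflection_matrix Q *v v) $ i" and "0 < T"
    and \<xi>: "\<xi> \<in> (\<Pi> i\<in>UNIV. skorokhod_drift T (\<beta> $ i))"
    and \<zeta>: "\<zeta> \<in> (\<Pi> i\<in>UNIV. skorokhod_drift T (\<beta> $ i))" and b: "\<And>i. \<bar>\<beta> $ i\<bar> \<le> b"
    and close: "\<And>i. dist_J1 T (\<xi> i) (\<zeta> i) < e"
  shows "dist_J1 T (content_map T Q \<xi> i) (content_map T Q \<zeta> i)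
    \<le> (1 + (\<Sum>j\<in>UNIV. \<bar>reflection_matrix Q $ i $ j\<bar> * ((1 + 3 * b) * v $ j))) * e"
proof -
  let ?A = "reflection_matrix Q"
  have "0 \<le> b" using b[of undefined] by linarith
  have "0 \<le> e"
    using close[of i] dist_J1_nonneg[of T "\<xi> i" "\<zeta> i"] \<open>0 < T\<close> by linarith
  let ?S = "\<Sum>j\<in>UNIV. \<bar>?A $ i $ j\<bar> * ((1 + 3 * b) * v $ j)"
  have "0 \<le> ?S"
    using v(1) \<open>0 \<le> b\<close> by (intro sum_nonneg) auto
  then have "e \<le> (1 + ?S) * e"
    using mult_right_mono[of 1 "1 + ?S" e] \<open>0 \<le> e\<close> by simp
  have "bounded (\<xi> i ` {0..T})" "bounded (\<zeta> i ` {0..T})"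
    using \<xi> \<zeta> by (auto intro: skorokhod_drift_bounded)
  then obtain l where l: "l \<in> time_changes T"
    and near: "\<And>t. t \<in> {0..T} \<Longrightarrow> \<bar>\<xi> i (l t) - \<zeta> i t\<bar> \<le> e"
      "\<And>t. t \<in> {0..T} \<Longrightarrow> \<bar>l t - t\<bar> \<le> e"
    using dist_J1_lessE[OF close] by metis
  show ?thesis
  proof (rule dist_J1_le[OF _ l])
    fix t assume t: "t \<in> {0..T}"
    note lt = time_changes_maps_to[OF l t]
    have reg: "\<bar>regulator T Q \<xi> j (l t) - regulator T Q \<zeta> j t\<bar> \<le> (1 + 3 * b) * v $ j * e" for j
    proof -
      have "\<bar>regulator T Q \<xi> j (l t) - regulator T Q \<xi> j t\<bar> \<le> b * v $ j * \<bar>l t - t\<bar>"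
        by (rule regulator_Lipschitz_in_time[OF v \<open>0 < T\<close> \<xi> b lt t])
      also have "\<dots> \<le> b * v $ j * e"
        using near(2)[OF t] v(1) \<open>0 \<le> b\<close> by (intro mult_left_mono) auto
      finally show ?thesis
        using regulator_uniform_estimate[OF v \<open>0 < T\<close> \<xi> \<zeta> b close t, of j]
        by (simp add: algebra_simps)
    qed
    have "content_map T Q \<xi> i (l t) - content_map T Q \<zeta> i t = (\<xi> i (l t) - \<zeta> i t)
        + (\<Sum>j\<in>UNIV. ?A $ i $ j * (regulator T Q \<xi> j (l t) - regulator T Q \<zeta> j t))"
      by (simp add: content_map_def apply_matrix_eq_sum right_diff_distrib sum_subtractf)
    also have "\<bar>\<dots>\<bar> \<le> \<bar>\<xi> i (l t) - \<zeta> i t\<bar>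
        + (\<Sum>j\<in>UNIV. \<bar>?A $ i $ j * (regulator T Q \<xi> j (l t) - regulator T Q \<zeta> j t)\<bar>)"
      by (intro order_trans[OF abs_triangle_ineq] add_left_mono sum_abs)
    also have "\<dots> \<le> e + (\<Sum>j\<in>UNIV. \<bar>?A $ i $ j\<bar> * ((1 + 3 * b) * v $ j * e))"
      unfolding abs_mult by (intro add_mono sum_mono mult_left_mono near(1) t reg) auto
    also have "\<dots> = (1 + ?S) * e"
      by (simp add: distrib_right sum_distrib_right mult.assoc)
    finally show "\<bar>content_map T Q \<xi> i (l t) - content_map T Q \<zeta> i t\<bar> \<le> (1 + ?S) * e" .
    show "\<bar>l t - t\<bar> \<le> (1 + ?S) * e"
      using near(2)[OF t] \<open>e \<le> (1 + ?S) * e\<close> by linarith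
  qed (use \<open>0 < T\<close> in auto)
qed

lemma regulator_J1_estimate:
  fixes v \<beta> :: "real^'d"
  assumes v: "\<And>i. 0 \<le> v $ i" "\<And>i. 1 \<le> (reflection_matrix Q *v v) $ i" and "0 < T"
    and \<xi>: "\<xi> \<in> (\<Pi> i\<in>UNIV. skorokhod_drift T (\<beta> $ i))"
    and \<zeta>: "\<zeta> \<in> (\<Pi> i\<in>UNIV. skorokhod_drift T (\<beta> $ i))" and b: "\<And>i. \<bar>\<beta> $ i\<bar> \<le> b"
    and close: "\<And>i. dist_J1 T (\<xi> i) (\<zeta> i) < e"
  shows "dist_J1 T (regulator T Q \<xi> i) (regulator T Q \<zeta> i) \<le> (1 + 2 * b) * v $ i * e"
  using regulator_uniform_estimate[OF assms, of _ i] \<open>0 < T\<close>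
  by (intro dist_J1_le[OF _ id_in_time_changes])
     (auto simp: mult_ac intro: order_trans[OF abs_ge_zero])

section \<open>Lipschitz continuity of the reflection map\<close>

text \<open>
  The estimates above are for arbitrary \<open>e\<close> strictly above all coordinate distances, since the
  infimum in the \<open>J\<^sub>1\<close> distance need not be attained; letting \<open>e\<close> decrease to the product distance
  gives the Lipschitz bound.
\<close>

lemma lipschitz_map_dist_prodI:
  fixes F :: "('d::finite \<Rightarrow> real \<Rightarrow> real) \<Rightarrow> 'd \<Rightarrow> real \<Rightarrow> real"
  assumes "0 < T" and maps: "F \<in> X \<rightarrow> Y" and c: "\<And>i. 0 \<le> c i"
    and est: "\<And>\<xi> \<zeta> e i. \<xi> \<in> X \<Longrightarrow> \<zeta> \<in> X \<Longrightarrow> (\<And>i. dist_J1 T (\<xi> i) (\<zeta> i) < e) \<Longrightarrow>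
        dist_J1 T (F \<xi> i) (F \<zeta> i) \<le> c i * e"
  shows "lipschitz_map X (dist_prod T) Y (dist_prod T) F"
  unfolding lipschitz_map_def
proof (intro conjI exI ballI)
  show "F \<in> X \<rightarrow> Y" by (rule maps)
  show "0 \<le> (\<Sum>i\<in>UNIV. c i)" by (intro sum_nonneg c)
  fix \<xi> \<zeta> assume X: "\<xi> \<in> X" "\<zeta> \<in> X"
  have coord: "dist_J1 T (\<xi> i) (\<zeta> i) \<le> dist_prod T \<xi> \<zeta>" for i
    unfolding dist_prod_def using \<open>0 < T\<close> by (intro member_le_sum dist_J1_nonneg) auto
  have "dist_J1 T (F \<xi> i) (F \<zeta> i) \<le> c i * dist_prod T \<xi> \<zeta>" for i
  proof (rule tendsto_lowerbound)
    show "((\<lambda>e. c i * e) \<longlongrightarrow> c i * dist_prod T \<xi> \<zeta>) (at_right (dist_prod T \<xi> \<zeta>))"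
      by (intro tendsto_intros)
    have "dist_J1 T (F \<xi> i) (F \<zeta> i) \<le> c i * e" if "dist_prod T \<xi> \<zeta> < e" for e
      using coord that by (intro est[OF X]) (rule le_less_trans)
    then show "\<forall>\<^sub>F e in at_right (dist_prod T \<xi> \<zeta>). dist_J1 T (F \<xi> i) (F \<zeta> i) \<le> c i * e"
      by (simp add: eventually_at_filter)
  qed simp
  then show "dist_prod T (F \<xi>) (F \<zeta>) \<le> (\<Sum>i\<in>UNIV. c i) * dist_prod T \<xi> \<zeta>"
    unfolding dist_prod_def[of T "F \<xi>"] sum_distrib_right by (rule sum_mono)
qed

theorem theorem2p1:
  fixes T :: real and Q :: "real^'d^'d" and \<beta> :: "real^'d"
  assumes "0 < T"
    and "\<forall>i j. 0 \<le> Q $ i $ j"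
    and "\<forall>i. (\<Sum>j\<in>UNIV. Q $ i $ j) \<le> 1"
    and "\<forall>i. Q $ i $ i = 0"
    and "(\<lambda>n. matrix_power Q n) \<longlonglongrightarrow> 0"
  shows "lipschitz_map (\<Pi> i\<in>UNIV. skorokhod_drift T (\<beta> $ i)) (dist_prod T)
           (\<Pi> i\<in>UNIV. skorokhod T) (dist_prod T) (content_map T Q)
       \<and> lipschitz_map (\<Pi> i\<in>UNIV. skorokhod_drift T (\<beta> $ i)) (dist_prod T)
           (\<Pi> i\<in>UNIV. skorokhod T) (dist_prod T) (regulator T Q)"
proof -
  let ?X = "\<Pi> i\<in>UNIV. skorokhod_drift T (\<beta> $ i)"
  obtain v :: "real^'d" where v: "\<And>i. 0 \<le> v $ i" "\<And>i. 1 \<le> (reflection_matrix Q *v v) $ i"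
    using reflection_matrix_witness[OF assms(2,5)] by blast
  have b: "\<bar>\<beta> $ i\<bar> \<le> norm \<beta>" for i
    by (rule component_le_norm_cart)
  have continuous: "continuous_on {0..T} (regulator T Q \<xi> i)" if "\<xi> \<in> ?X" for \<xi> i
    by (rule regulator_continuous_on[OF v assms(1) that b])
  show ?thesis
  proof
    show "lipschitz_map ?X (dist_prod T) (\<Pi> i\<in>UNIV. skorokhod T) (dist_prod T) (regulator T Q)"
    proof (rule lipschitz_map_dist_prodI[OF assms(1)])
      show "regulator T Q \<in> ?X \<rightarrow> (\<Pi> i\<in>UNIV. skorokhod T)"
        by (intro funcsetI Pi_I) (rule skorokhodI_continuous[OF continuous])
      show "0 \<le> (1 + 2 * norm \<beta>) * v $ i" for i
        using v(1) by simp
    qed (rule regulator_J1_estimate[OF v assms(1) _ _ b])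
    show "lipschitz_map ?X (dist_prod T) (\<Pi> i\<in>UNIV. skorokhod T) (dist_prod T) (content_map T Q)"
    proof (rule lipschitz_map_dist_prodI[OF assms(1)])
      show "content_map T Q \<in> ?X \<rightarrow> (\<Pi> i\<in>UNIV. skorokhod T)"
      proof (intro funcsetI Pi_I)
        fix \<xi> i assume \<xi>: "\<xi> \<in> ?X"
        then have "\<xi> i \<in> skorokhod T"
          using skorokhod_drift_subset by blast
        then show "content_map T Q \<xi> i \<in> skorokhod T"
          unfolding content_map_def apply_matrix_eq_sum
          by (rule skorokhod_add) (intro skorokhodI_continuous continuous_intros continuous \<xi>)
      qed
      show "0 \<le> 1 + (\<Sum>j\<in>UNIV. \<bar>reflection_matrix Q $ i $ j\<bar> * ((1 + 3 * norm \<beta>) * v $ j))" for i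
        using v(1) by (intro add_nonneg_nonneg sum_nonneg) auto
    qed (rule content_J1_estimate[OF v assms(1) _ _ b])
  qed
qed

end
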